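(* For $n\ge 2$ let $a(n) = \max\{ M(n,h) : 1 \le h \le n-1\}$ be the maximum number of leaf pairs at the largest level, taken over all extended binary trees with $n$ leaves. Then for every $n \ge 2$, \[ a(n) = M( n, \lceil \lg n \rceil ) = a_1 (n-1), \] where $\lg=\log_2$ and $a_1(m)$ is the number of leaves among the first $m$ nodes of the infinite labelled tree $\mathcal{F}_1$.
   Context: An extended binary tree is a finite rooted ordered tree in which every node has either no children (a leaf) or two children (an internal node). The root is at level $0$; the height is the length of the longest path from the root to a leaf. For $h\ge1$, $M(n,h)$ is the maximum number of leaf pairs at level $h$ (equivalently, of internal nodes at level $h-1$) over all extended binary trees with $n$ leaves and height $h$; it is $0$ if there is no such tree. The infinite tree $\mathcal{F}_1$ is built as follows. It contains an initial single-node tree (one leaf); for each $h \ge 1$ a complete binary tree with $2^h-1$ nodes, called subtree $h$; and for each $h\ge 1$ a node $y_h$. The right child of $y_h$ is the root of subtree $h$; the left child of $y_h$ is $y_{h-1}$ if $h \ge 2$, and is the initial single-node tree if $h=1$. Labels $1,2,3,\ldots$ are given to the nodes in the following order: the initial single node, $y_1$, the nodes of subtree $1$ in preorder, $y_2$, the nodes of subtree $2$ in preorder, and so on. The leaves of $\mathcal{F}_1$ are the initial single node and the leaves of the subtrees $h\ge1$; all other nodes are internal. $a_1(m)$ is the number of leaves among the nodes labelled $1,\ldots,m$. *)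

theory Defs
  imports Complex_Main "HOL-Library.Tree"
begin

text \<open>
  Extended binary trees are values of type \<^typ>\<open>unit tree\<close>: \<^const>\<open>Node\<close> is an internal node,
  \<^const>\<open>Leaf\<close> is a leaf that counts as a node of the tree. The number of leaves of \<open>t\<close> is
  \<open>size1 t\<close>, and \<open>height t\<close> is the length of a longest path from the root to a leaf.
\<close>

text \<open>\<open>leaf_pairs h t\<close> counts the pairs of sibling leaves at level \<open>h\<close>, the root being at level 0.\<close>

fun leaf_pairs :: "nat \<Rightarrow> 'a tree \<Rightarrow> nat" where
  "leaf_pairs h Leaf = 0"
| "leaf_pairs 0 (Node l x r) = 0"
| "leaf_pairs (Suc 0) (Node l x r) = (if l = Leaf \<and> r = Leaf then 1 else 0)"
| "leaf_pairs (Suc (Suc h)) (Node l x r) = leaf_pairs (Suc h) l + leaf_pairs (Suc h) r"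

definition trees_with :: "nat \<Rightarrow> nat \<Rightarrow> unit tree set" where
  "trees_with n h = {t. size1 t = n \<and> height t = h}"

definition max_leaf_pairs :: "nat \<Rightarrow> nat \<Rightarrow> nat" where
  "max_leaf_pairs n h =
     (if trees_with n h = {} then 0 else Max (leaf_pairs h ` trees_with n h))"

definition a_max :: "nat \<Rightarrow> nat" where
  "a_max n = Max {max_leaf_pairs n h | h. 1 \<le> h \<and> h \<le> n - 1}"

lemma leaf_pairs_less_size1: "leaf_pairs h t < size1 t"
  by (induction h t rule: leaf_pairs.induct) auto

text \<open>The maximum in \<open>max_leaf_pairs\<close> is over a finite set.\<close>

lemma finite_leaf_pairs: "finite (leaf_pairs h ` trees_with n h)"
  by (rule finite_subset[of _ "{..<n}"])
     (use leaf_pairs_less_size1 in \<open>auto simp: trees_with_def\<close>)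

text \<open>
  The nodes of the infinite tree: \<open>Init\<close> is the initial single-node tree, \<open>Y h\<close> is $y_h$, and
  \<open>Sub h p\<close> is the node of subtree \<open>h\<close> reached from its root by the path \<open>p\<close>
  (\<^const>\<open>False\<close> = left, \<^const>\<open>True\<close> = right). The actual nodes are \<open>Init\<close>, \<open>Y h\<close> with \<open>h \<ge> 1\<close> and
  \<open>Sub h p\<close> with \<open>length p < h\<close>: a complete binary tree with $2^h - 1$ nodes has levels
  \<open>0, \<dots>, h - 1\<close>. The remaining values of the type are junk and never receive a label.
\<close>

datatype F1_node = Init | Y nat | Sub nat "bool list"

fun left_child :: "F1_node \<Rightarrow> F1_node option" where
  "left_child Init = None"
| "left_child (Y h) = Some (if h \<ge> 2 then Y (h - 1) else Init)"
| "left_child (Sub h p) = (if length p + 1 < h then Some (Sub h (p @ [False])) else None)"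

fun right_child :: "F1_node \<Rightarrow> F1_node option" where
  "right_child Init = None"
| "right_child (Y h) = Some (Sub h [])"
| "right_child (Sub h p) = (if length p + 1 < h then Some (Sub h (p @ [True])) else None)"

definition F1_leaf :: "F1_node \<Rightarrow> bool" where
  "F1_leaf v \<longleftrightarrow> left_child v = None \<and> right_child v = None"

text \<open>
  Preorder listing of the descendants of \<open>v\<close> (including \<open>v\<close>) at depth less than \<open>k\<close> below \<open>v\<close>;
  the bound \<open>k\<close> only makes the recursion terminate. Subtree \<open>h\<close> has \<open>h\<close> levels, so
  \<open>preorder_below h (Sub h [])\<close> lists all of it.
\<close>

fun preorder_below :: "nat \<Rightarrow> F1_node \<Rightarrow> F1_node list" where
  "preorder_below 0 v = []"
| "preorder_below (Suc k) v =
     v # (case left_child v of None \<Rightarrow> [] | Some l \<Rightarrow> preorder_below k l)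
       @ (case right_child v of None \<Rightarrow> [] | Some r \<Rightarrow> preorder_below k r)"

definition label_prefix :: "nat \<Rightarrow> F1_node list" where
  "label_prefix H = Init # concat (map (\<lambda>h. Y h # preorder_below h (Sub h [])) [1..<H + 1])"

lemma length_label_prefix: "length (label_prefix H) > H"
  by (induction H) (auto simp: label_prefix_def)

text \<open>
  The node with label \<open>i \<ge> 1\<close>. The lists \<open>label_prefix H\<close> are prefixes of one another, and
  \<open>label_prefix i\<close> has more than \<open>i\<close> elements, so this is position \<open>i\<close> (counting from 1)
  in the infinite labelling sequence.
\<close>

definition node_labelled :: "nat \<Rightarrow> F1_node" where
  "node_labelled i = label_prefix i ! (i - 1)"

definition a1 :: "nat \<Rightarrow> nat" where
  "a1 m = card {i \<in> {1..m}. F1_leaf (node_labelled i)}"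

end

theory Submission
  imports Defs
begin

text \<open>
  A tree with \<open>k\<close> leaf pairs at level \<open>h\<close> has at least \<open>\<lceil>k / 2^j\<rceil>\<close> internal nodes at level
  \<open>h - 1 - j\<close>, so it needs at least \<open>N h k = (\<Sum>j<h. \<lceil>k / 2^j\<rceil>)\<close> internal nodes. Filling the left
  subtree first shows that this bound is sharp, and that every number of internal nodes from
  \<open>N h k\<close> up to \<open>2^(h-1) - 1 + k\<close> occurs. Since \<open>N h k\<close> grows with \<open>h\<close>, the least possible
  height \<open>h = \<lceil>lg n\<rceil>\<close> is the best one, and the maximum is the largest \<open>k\<close> with \<open>N h k \<le> n - 1\<close>.
  On the other hand, \<open>N h k\<close> is the position of the \<open>k\<close>-th leaf in the preorder of the complete
  binary tree with \<open>h\<close> levels, which makes it also the label of the \<open>k\<close>-th leaf of the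
  infinite tree when \<open>2^(h-2) < k \<le> 2^(h-1)\<close>.
\<close>

section \<open>Arithmetic of rounded-up quotients and their sums\<close>

definition ceil_div :: "nat \<Rightarrow> nat \<Rightarrow> nat" where
  "ceil_div k q = (k + q - 1) div q"

text \<open>This is \<open>N h k\<close> of the overview; summand \<open>j\<close> bounds the
  internal nodes at level \<open>h - 1 - j\<close> from below.\<close>

definition min_inner :: "nat \<Rightarrow> nat \<Rightarrow> nat" where
  "min_inner h k = (\<Sum>j<h. ceil_div k (2 ^ j))"

text \<open>This adjunction between rounded-up division and multiplication yields monotonicity and
  subadditivity without further division arithmetic.\<close>

lemma ceil_div_le_iff: "q > 0 \<Longrightarrow> ceil_div k q \<le> x \<longleftrightarrow> k \<le> x * q"
proof -
  assume q: "q > 0"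
  have "ceil_div k q < Suc x \<longleftrightarrow> k + q - 1 < Suc x * q"
    unfolding ceil_div_def using q by (rule div_less_iff_less_mult)
  then show ?thesis using q by auto
qed

lemma le_ceil_div_mult: "q > 0 \<Longrightarrow> k \<le> ceil_div k q * q"
  using ceil_div_le_iff[of q k "ceil_div k q"] by simp

lemma ceil_div_mono: "q > 0 \<Longrightarrow> k \<le> l \<Longrightarrow> ceil_div k q \<le> ceil_div l q"
  using ceil_div_le_iff le_ceil_div_mult le_trans by blast

lemma ceil_div_add_le:
  "q > 0 \<Longrightarrow> ceil_div (k + l) q \<le> ceil_div k q + ceil_div l q"
  using le_ceil_div_mult[of q k] le_ceil_div_mult[of q l]
  by (simp add: ceil_div_le_iff add_mult_distrib)

lemma ceil_div_mult_add: "q > 0 \<Longrightarrow> ceil_div (x * q + k) q = x + ceil_div k q"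
  unfolding ceil_div_def
  by (metis One_nat_def Suc_leI add.assoc diff_add_assoc div_mult_self3 le_add2 le_trans
      less_irrefl_nat)

lemma ceil_div_1 [simp]: "ceil_div k (Suc 0) = k"
  by (simp add: ceil_div_def)

lemma ceil_div_eq_1: "0 < k \<Longrightarrow> k \<le> q \<Longrightarrow> ceil_div k q = 1"
  using ceil_div_le_iff[of q k 1] ceil_div_le_iff[of q k 0] by simp

lemma min_inner_1 [simp]: "min_inner (Suc 0) k = k"
  by (simp add: min_inner_def)

lemma min_inner_0_right [simp]: "min_inner h 0 = 0"
  by (simp add: min_inner_def ceil_div_def)

lemma min_inner_one: "min_inner h 1 = h"
  by (simp add: min_inner_def ceil_div_eq_1)

text \<open>The added summand is 1: a single new root suffices above the old levels.\<close>

lemma min_inner_Suc: "0 < k \<Longrightarrow> k \<le> 2 ^ h \<Longrightarrow> min_inner (Suc h) k = Suc (min_inner h k)"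
  by (simp add: min_inner_def ceil_div_eq_1)

lemma min_inner_mono: "h \<le> h' \<Longrightarrow> k \<le> l \<Longrightarrow> min_inner h k \<le> min_inner h' l"
  unfolding min_inner_def
  by (rule order_trans[OF sum_mono sum_mono2]) (auto intro: ceil_div_mono)

text \<open>The summand for \<open>j = 0\<close> is the argument itself and grows strictly; the
  others grow weakly. With no summand this would fail, hence \<open>Suc h\<close>.\<close>

lemma min_inner_strict_mono:
  assumes "k < l"
  shows "min_inner (Suc h) k < min_inner (Suc h) l"
proof -
  have "(\<Sum>j<h. ceil_div k (2 ^ Suc j)) \<le> (\<Sum>j<h. ceil_div l (2 ^ Suc j))"
    using assms by (intro sum_mono ceil_div_mono) auto
  then show ?thesis
    using assms unfolding min_inner_def sum.lessThan_Suc_shift by simp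
qed

lemma min_inner_add_le: "min_inner h (k + l) \<le> min_inner h k + min_inner h l"
  unfolding min_inner_def by (simp add: sum.distrib[symmetric] sum_mono ceil_div_add_le)

text \<open>Every \<open>2 ^ j\<close> with \<open>j \<le> h\<close> divides \<open>2 ^ h\<close>,
  so \<open>2 ^ (h - j)\<close> leaves each ceiling; these powers form a geometric sum.\<close>

lemma min_inner_power_add:
  "min_inner (Suc h) (2 ^ h + k) = 2 ^ Suc h - 1 + min_inner (Suc h) k"
proof -
  have "ceil_div (2 ^ h + k) (2 ^ j) = 2 ^ (h - j) + ceil_div k (2 ^ j)" if "j < Suc h" for j
    using ceil_div_mult_add[of "2 ^ j" "2 ^ (h - j)" k] that
    by (simp flip: power_add)
  then have "min_inner (Suc h) (2 ^ h + k) = (\<Sum>j<Suc h. 2 ^ (h - j)) + min_inner (Suc h) k"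
    unfolding min_inner_def by (simp only: sum.distrib[symmetric]) (intro sum.cong, auto)
  also have "(\<Sum>j<Suc h. 2 ^ (h - j) :: nat) = (\<Sum>j<Suc h. 2 ^ j)"
    using sum.nat_diff_reindex[of "\<lambda>j. 2 ^ j :: nat" "Suc h"] by simp
  also have "\<dots> = 2 ^ Suc h - 1"
    by (simp only: lessThan_def One_nat_def mask_eq_sum_exp_nat)
  finally show ?thesis .
qed

lemma min_inner_power: "min_inner (Suc h) (2 ^ h) = 2 ^ Suc h - 1"
  using min_inner_power_add[of h 0] by simp

text \<open>One root and a complete left subtree cost \<open>2 ^ Suc h\<close> nodes; the remaining
  \<open>k\<close> pairs go to the right. Trees, preorder and labelling all follow this
  recursion.\<close>

lemma min_inner_Suc_power_add:
  assumes "k \<le> 2 ^ h"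
  shows "min_inner (Suc (Suc h)) (2 ^ h + k) = 2 ^ Suc h + min_inner (Suc h) k"
  using assms by (simp add: min_inner_Suc min_inner_power_add)

text \<open>The right side is the size when all levels above the \<open>k\<close> lowest internal
  nodes are full. Thus the range of sizes in \<open>ex_tree_leaf_pairs\<close> is never
  empty.\<close>

lemma min_inner_le:
  assumes "k \<le> 2 ^ h"
  shows "min_inner (Suc h) k \<le> 2 ^ h - 1 + k"
  using assms
proof (induction h arbitrary: k)
  case (Suc h)
  show ?case
  proof (cases "k \<le> 2 ^ h")
    case True
    then show ?thesis
      using Suc.IH[of k] by (cases "k = 0") (auto simp: min_inner_Suc)
  next
    case False
    define j where "j = k - 2 ^ h"
    have "k = 2 ^ h + j" "j \<le> 2 ^ h" using False Suc.prems by (auto simp: j_def)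
    then show ?thesis using Suc.IH[of j] by (simp add: min_inner_Suc_power_add)
  qed
qed simp

section \<open>Leaf pairs\<close>

lemma leaf_pairs_le_power: "leaf_pairs (Suc h) t \<le> 2 ^ h"
proof (induction h arbitrary: t)
  case 0
  show ?case by (cases t) auto
next
  case (Suc h)
  show ?case
  proof (cases t)
    case (Node l x r)
    then show ?thesis using Suc.IH[of l] Suc.IH[of r] by simp
  qed simp
qed

text \<open>Induction on the level: the root pays for the extra summand, and subadditivity splits
  the rest between the two subtrees.\<close>

lemma min_inner_leaf_pairs_le_size: "min_inner (Suc h) (leaf_pairs (Suc h) t) \<le> size t"
proof (induction h arbitrary: t)
  case 0
  show ?case by (cases t) auto
next
  case (Suc h)
  show ?case
  proof (cases t)
    case (Node l x r)
    let ?k = "leaf_pairs (Suc h) l + leaf_pairs (Suc h) r"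
    have "min_inner (Suc (Suc h)) ?k \<le> Suc (min_inner (Suc h) ?k)"
      using leaf_pairs_le_power[of "Suc h" t] Node by (cases "?k = 0") (auto simp: min_inner_Suc)
    also have "min_inner (Suc h) ?k
        \<le> min_inner (Suc h) (leaf_pairs (Suc h) l) + min_inner (Suc h) (leaf_pairs (Suc h) r)"
      by (rule min_inner_add_le)
    finally show ?thesis using Suc.IH[of l] Suc.IH[of r] Node by simp
  qed simp
qed

text \<open>The height is only bounded above, so that subtrees without pairs, even
  \<open>Leaf\<close>, fit the induction.\<close>

lemma ex_tree_leaf_pairs:
  assumes "k \<le> 2 ^ h" "min_inner (Suc h) k \<le> m" "m \<le> 2 ^ h - 1 + k"
  shows "\<exists>t :: unit tree. size t = m \<and> height t \<le> Suc h \<and> leaf_pairs (Suc h) t = k"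
  using assms
proof (induction h arbitrary: k m)
  case 0
  then have "m = k" "k = 0 \<or> k = 1" by auto
  then show ?case
    by (auto intro: exI[of _ Leaf] exI[of _ "Node Leaf () Leaf"])
next
  case (Suc h)
  have node: ?case
    if l: "\<exists>l :: unit tree. size l = m1 \<and> height l \<le> Suc h \<and> leaf_pairs (Suc h) l = k1"
      and r: "\<exists>r :: unit tree. size r = m2 \<and> height r \<le> Suc h \<and> leaf_pairs (Suc h) r = k2"
      and mk: "m = Suc (m1 + m2)" "k = k1 + k2" for m1 m2 k1 k2
  proof -
    obtain l r :: "unit tree"
      where "size l = m1" "height l \<le> Suc h" "leaf_pairs (Suc h) l = k1"
        "size r = m2" "height r \<le> Suc h" "leaf_pairs (Suc h) r = k2"
      using l r by blast
    then show ?thesis using mk by (intro exI[of _ "Node l () r"]) auto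
  qed
  consider "m = 0" | "m > 0" "k \<le> 2 ^ h" | "k > 2 ^ h" by linarith
  then show ?case
  proof cases
    case 1
    have "k = 0"
      using Suc.prems(2) 1 min_inner_strict_mono[of 0 k "Suc h"] by (cases "k = 0") auto
    then show ?thesis using 1 by (intro exI[of _ Leaf]) auto
  next
    case 2
    \<comment> \<open>All pairs go left, with as many nodes as the left side can hold; the overflow
      goes right, without pairs.\<close>
    define m1 where "m1 = min (m - 1) (2 ^ h - 1 + k)"
    have "min_inner (Suc h) k \<le> m - 1"
      using Suc.prems(2) 2 by (cases "k = 0") (auto simp: min_inner_Suc)
    then have "min_inner (Suc h) k \<le> m1" using min_inner_le[OF 2(2)] by (simp add: m1_def)
    moreover have "m - 1 - m1 \<le> 2 ^ h - 1 + 0"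
      using Suc.prems(3) by (auto simp: m1_def)
    ultimately show ?thesis
      using 2 by (intro node[OF Suc.IH[of k m1] Suc.IH[of 0 "m - 1 - m1"]]) (auto simp: m1_def)
  next
    case 3
    \<comment> \<open>The left subtree is complete and holds \<open>2 ^ h\<close> pairs; the right
      one gets the other \<open>j\<close>.\<close>
    define j where "j = k - 2 ^ h"
    have j: "k = 2 ^ h + j" "j \<le> 2 ^ h" using 3 Suc.prems(1) by (auto simp: j_def)
    have m: "2 ^ Suc h + min_inner (Suc h) j \<le> m"
      using Suc.prems(2) j by (simp add: min_inner_Suc_power_add)
    have "m > 0" using m by (cases m) auto
    show ?thesis
    proof (rule node[OF Suc.IH[of "2 ^ h" "2 ^ Suc h - 1"] Suc.IH[of j "m - 2 ^ Suc h"]])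
      show "min_inner (Suc h) (2 ^ h) \<le> 2 ^ Suc h - 1" by (simp add: min_inner_power)
    qed (use m j Suc.prems(3) \<open>m > 0\<close> in auto)
  qed
qed

lemma leaf_pairs_pos_imp_le_height: "leaf_pairs h t > 0 \<Longrightarrow> h \<le> height t"
  by (induction h t rule: leaf_pairs.induct) (auto split: if_splits)

section \<open>The infinite tree\<close>

lemma F1_leaf_simps [simp]:
  "F1_leaf Init" "\<not> F1_leaf (Y h)" "F1_leaf (Sub h p) \<longleftrightarrow> h \<le> Suc (length p)"
  by (auto simp: F1_leaf_def)

text \<open>The hypothesis makes the depth bound \<open>k\<close> equal to the number of levels from
  \<open>Sub h p\<close> downwards, so nothing is cut off.\<close>

lemma length_preorder_below_Sub:
  "length p + k = h \<Longrightarrow> length (preorder_below k (Sub h p)) = 2 ^ k - 1"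
proof (induction k arbitrary: p)
  case (Suc k)
  show ?case
  proof (cases k)
    case (Suc k')
    \<comment> \<open>Writing the power as a successor eliminates truncated subtraction.\<close>
    obtain q :: nat where "2 ^ k' = Suc q" using gr0_implies_Suc[of "2 ^ k'"] by auto
    with Suc show ?thesis
      using Suc.prems by (subst preorder_below.simps)
        (simp add: Suc.IH[unfolded \<open>k = Suc k'\<close>] del: preorder_below.simps)
  qed (use Suc.prems in simp)
qed simp

lemma leaves_preorder_below_Sub:
  "length p + Suc k = h \<Longrightarrow>
    length (filter F1_leaf (preorder_below (Suc k) (Sub h p))) = 2 ^ k"
proof (induction k arbitrary: p)
  case (Suc k)
  then show ?case by (subst preorder_below.simps) (auto simp del: preorder_below.simps)
qed auto

lemma length_filter_take_le: "length (filter P (take m xs)) \<le> length (filter P xs)"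
  by (subst (2) append_take_drop_id[of m xs, symmetric]) (simp del: append_take_drop_id)

text \<open>Thus \<open>min_inner (Suc k) i\<close> is the position of the \<open>i\<close>-th leaf
  for \<open>i > 0\<close>: preorder visits the root, then the left half, then the right half, just
  as \<open>min_inner\<close> decomposes.\<close>

lemma le_leaves_take_preorder_iff:
  assumes "length p + Suc k = h" "i \<le> 2 ^ k"
  shows "i \<le> length (filter F1_leaf (take m (preorder_below (Suc k) (Sub h p))))
    \<longleftrightarrow> min_inner (Suc k) i \<le> m"
  using assms
proof (induction k arbitrary: p i m)
  case 0
  then show ?case by (cases m) auto
next
  case (Suc k)
  define L where "L = preorder_below (Suc k) (Sub h (p @ [False]))"
  define R where "R = preorder_below (Suc k) (Sub h (p @ [True]))"
  define cL where "cL q = length (filter F1_leaf (take q L))" for q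
  define cR where "cR q = length (filter F1_leaf (take q R))" for q
  have pre: "preorder_below (Suc (Suc k)) (Sub h p) = Sub h p # L @ R"
    using Suc.prems(1) by (subst preorder_below.simps) (auto simp: L_def R_def)
  have len: "length L = 2 ^ Suc k - 1"
    unfolding L_def by (rule length_preorder_below_Sub) (use Suc.prems(1) in auto)
  have IHL: "j \<le> cL q \<longleftrightarrow> min_inner (Suc k) j \<le> q" if "j \<le> 2 ^ k" for j q
    using Suc.IH[of "p @ [False]" j q] Suc.prems(1) that by (simp only: cL_def L_def) simp
  have IHR: "j \<le> cR q \<longleftrightarrow> min_inner (Suc k) j \<le> q" if "j \<le> 2 ^ k" for j q
    using Suc.IH[of "p @ [True]" j q] Suc.prems(1) that by (simp only: cR_def R_def) simp
  have cL_le: "cL q \<le> 2 ^ k" for q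
    using length_filter_take_le[of F1_leaf q L]
      leaves_preorder_below_Sub[of "p @ [False]" k h] Suc.prems(1)
    by (simp add: cL_def L_def del: preorder_below.simps)
  have cL_full: "cL q = 2 ^ k" if "2 ^ Suc k - 1 \<le> q" for q
    using IHL[of "2 ^ k" q] cL_le[of q] that by (simp add: min_inner_power)
  have cR_0: "cR 0 = 0" by (simp add: cR_def)
  show ?case
  proof (cases m)
    case 0
    then show ?thesis
      using min_inner_strict_mono[of 0 i "Suc k"] by (cases "i = 0") auto
  next
    case (Suc m')
    \<comment> \<open>The root takes one position and is no leaf, which leaves \<open>m'\<close>
      positions for \<open>L @ R\<close>.\<close>
    have count: "length (filter F1_leaf (take m (preorder_below (Suc (Suc k)) (Sub h p))))
        = cL m' + cR (m' - (2 ^ Suc k - 1))"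
      unfolding pre using Suc Suc.prems(1) len by (simp add: cL_def cR_def)
    consider "i = 0" | "0 < i" "i \<le> 2 ^ k" | "i > 2 ^ k" by linarith
    then have "i \<le> cL m' + cR (m' - (2 ^ Suc k - 1)) \<longleftrightarrow> min_inner (Suc (Suc k)) i \<le> m"
    proof cases
      case 1
      then show ?thesis by simp
    next
      case 2
      have "min_inner (Suc (Suc k)) i = Suc (min_inner (Suc k) i)"
        using 2 by (simp add: min_inner_Suc)
      moreover have "i \<le> cL m' + cR (m' - (2 ^ Suc k - 1)) \<longleftrightarrow> i \<le> cL m'"
        \<comment> \<open>Once the right half is reached, the left half alone already supplies
          \<open>2 ^ k\<close> leaves.\<close>
        using 2 cL_full[of m'] cR_0 by (cases "2 ^ Suc k - 1 \<le> m'") auto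
      ultimately show ?thesis using IHL[of i m'] 2 Suc by simp
    next
      case 3
      define j where "j = i - 2 ^ k"
      have j: "i = 2 ^ k + j" "0 < j" "j \<le> 2 ^ k" using 3 Suc.prems(2) by (auto simp: j_def)
      have N: "min_inner (Suc (Suc k)) i = 2 ^ Suc k + min_inner (Suc k) j"
        using j by (simp add: min_inner_Suc_power_add)
      show ?thesis
      proof (cases "2 ^ Suc k - 1 \<le> m'")
        case True
        have "i \<le> cL m' + cR (m' - (2 ^ Suc k - 1)) \<longleftrightarrow> j \<le> cR (m' - (2 ^ Suc k - 1))"
          using cL_full[OF True] j by simp
        also have "\<dots> \<longleftrightarrow> min_inner (Suc (Suc k)) i \<le> m"
          unfolding IHR[OF j(3)] N using True Suc by auto
        finally show ?thesis .
      next
        case False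
        then have "cR (m' - (2 ^ Suc k - 1)) = 0" using cR_0 by simp
        then show ?thesis using cL_le[of m'] j False Suc unfolding N by auto
      qed
    qed
    then show ?thesis unfolding count .
  qed
qed

section \<open>Counting leaves along the labelling\<close>

lemma label_prefix_Suc:
  "label_prefix (Suc H) = label_prefix H @ Y (Suc H) # preorder_below (Suc H) (Sub (Suc H) [])"
  by (simp add: label_prefix_def del: preorder_below.simps)

lemma length_label_prefix_eq: "length (label_prefix H) = 2 ^ Suc H - 1"
proof (induction H)
  case (Suc H)
  then show ?case
    using length_preorder_below_Sub[of "[]" "Suc H" "Suc H"]
    by (simp add: label_prefix_Suc del: preorder_below.simps)
qed (simp add: label_prefix_def)

lemma leaves_label_prefix: "length (filter F1_leaf (label_prefix H)) = 2 ^ H"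
proof (induction H)
  case (Suc H)
  then show ?case
    using leaves_preorder_below_Sub[of "[]" H "Suc H"]
    by (simp add: label_prefix_Suc del: preorder_below.simps)
qed (simp add: label_prefix_def)

lemma label_prefix_nth:
  assumes "i < length (label_prefix H)" "H \<le> H'"
  shows "label_prefix H' ! i = label_prefix H ! i"
  using assms(2)
proof (induction rule: dec_induct)
  case (step J)
  have "length (label_prefix H) \<le> length (label_prefix J)"
    unfolding length_label_prefix_eq using step.hyps by (intro diff_le_mono power_increasing) auto
  then show ?case using step.IH assms(1) by (simp add: label_prefix_Suc nth_append)
qed simp

lemma node_labelled_eq_nth:
  assumes "i < length (label_prefix H)"
  shows "node_labelled (Suc i) = label_prefix H ! i"
proof -
  have "i < length (label_prefix (Suc i))" using length_label_prefix[of "Suc i"] by linarith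
  then show ?thesis
    unfolding node_labelled_def using assms label_prefix_nth nat_le_linear
    by (metis diff_Suc_1)
qed

lemma a1_eq_leaves_take:
  assumes "m \<le> length (label_prefix H)"
  shows "a1 m = length (filter F1_leaf (take m (label_prefix H)))"
proof -
  have "{i \<in> {1..m}. F1_leaf (node_labelled i)}
      = Suc ` {i. i < m \<and> F1_leaf (label_prefix H ! i)}"
  proof (intro set_eqI iffI)
    fix x assume x: "x \<in> {i \<in> {1..m}. F1_leaf (node_labelled i)}"
    then obtain i where "x = Suc i" by (cases x) auto
    then show "x \<in> Suc ` {i. i < m \<and> F1_leaf (label_prefix H ! i)}"
      using x assms by (auto simp: node_labelled_eq_nth[of i H])
  qed (use assms in \<open>auto simp: node_labelled_eq_nth[of _ H]\<close>)
  then have "a1 m = card {i. i < m \<and> F1_leaf (label_prefix H ! i)}"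
    unfolding a1_def by (simp add: card_image)
  also have "{i. i < m \<and> F1_leaf (label_prefix H ! i)}
      = {i. i < length (take m (label_prefix H)) \<and> F1_leaf (take m (label_prefix H) ! i)}"
    using assms by auto
  finally show ?thesis unfolding length_filter_conv_card .
qed

lemma a1_le_power:
  assumes "m < 2 ^ Suc h"
  shows "a1 m \<le> 2 ^ h"
  using a1_eq_leaves_take[of m h] length_filter_take_le[of F1_leaf m "label_prefix h"] assms
  by (simp add: length_label_prefix_eq leaves_label_prefix)

text \<open>For \<open>h \<ge> 1\<close> the label \<open>m\<close> lies in the block of
  \<open>Y h\<close> and subtree \<open>h\<close>. The earlier blocks contribute
  \<open>2 ^ h - 1\<close> nodes and \<open>2 ^ (h - 1)\<close> leaves, the same shift as in
  \<open>min_inner_Suc_power_add\<close>.\<close>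

lemma le_a1_iff:
  assumes "2 ^ h \<le> m" "m < 2 ^ Suc h" "k \<le> 2 ^ h"
  shows "k \<le> a1 m \<longleftrightarrow> min_inner (Suc h) k \<le> m"
proof -
  have a1: "a1 m = length (filter F1_leaf (take m (label_prefix h)))"
    by (rule a1_eq_leaves_take) (use assms(2) in \<open>simp add: length_label_prefix_eq\<close>)
  show ?thesis
  proof (cases h)
    case 0
    then have "m = 1" using assms by simp
    then show ?thesis using a1 0 by (simp add: label_prefix_def)
  next
    case (Suc g)
    define c where "c = length (filter F1_leaf
      (take (m - 2 ^ Suc g) (preorder_below (Suc g) (Sub (Suc g) []))))"
    \<comment> \<open>The extra one is the internal node \<open>Y (Suc g)\<close> that opens the
      block.\<close>
    have "m - (2 ^ Suc g - 1) = Suc (m - 2 ^ Suc g)" using assms(1) Suc by simp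
    then have a1': "a1 m = 2 ^ g + c"
      using assms(1) Suc
      by (simp add: a1 label_prefix_Suc length_label_prefix_eq leaves_label_prefix c_def
          del: preorder_below.simps)
    show ?thesis
    proof (cases "k \<le> 2 ^ g")
      \<comment> \<open>Both sides of the equivalence hold here.\<close>
      case True
      have "min_inner (Suc h) k \<le> min_inner (Suc h) (2 ^ g)"
        using True by (intro min_inner_mono) auto
      also have "\<dots> = 2 ^ h"
        using min_inner_Suc_power_add[of 0 g] Suc by simp
      finally show ?thesis using assms(1) a1' True by auto
    next
      case False
      define j where "j = k - 2 ^ g"
      have j: "k = 2 ^ g + j" "j \<le> 2 ^ g" using False assms(3) Suc by (auto simp: j_def)
      have "k \<le> a1 m \<longleftrightarrow> j \<le> c" using a1' j by simp
      also have "\<dots> \<longleftrightarrow> min_inner (Suc g) j \<le> m - 2 ^ Suc g"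
        unfolding c_def by (rule le_leaves_take_preorder_iff) (use j in auto)
      also have "\<dots> \<longleftrightarrow> min_inner (Suc h) k \<le> m"
        using assms(1) Suc min_inner_Suc_power_add[OF j(2)] j(1) by auto
      finally show ?thesis .
    qed
  qed
qed

section \<open>Matching bounds and the conclusion\<close>

lemma leaf_pairs_le_a1:
  assumes "2 ^ h \<le> size t" "size t < 2 ^ Suc h"
  shows "leaf_pairs (height t) t \<le> a1 (size t)"
proof -
  let ?k = "leaf_pairs (height t) t"
  have "2 ^ h < (2 :: nat) ^ height t"
    using size1_height[of t] assms(1) unfolding size1_size by linarith
  then have "h < height t" by simp
  then obtain g where g: "height t = Suc g" "h \<le> g" by (cases "height t") auto
  have "min_inner (Suc h) ?k \<le> min_inner (Suc g) ?k"
    using g by (intro min_inner_mono) auto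
  also have "\<dots> \<le> size t"
    unfolding g by (rule min_inner_leaf_pairs_le_size)
  finally have N: "min_inner (Suc h) ?k \<le> size t" .
  have "?k \<le> 2 ^ h"
  proof (rule ccontr)
    assume "\<not> ?k \<le> 2 ^ h"
    then have "min_inner (Suc h) (2 ^ h) < min_inner (Suc h) ?k"
      by (intro min_inner_strict_mono) simp
    then show False using N assms(2) by (simp add: min_inner_power)
  qed
  then show ?thesis using N le_a1_iff[OF assms] by blast
qed

text \<open>The count \<open>a1 m\<close> satisfies the size bounds of
  \<open>ex_tree_leaf_pairs\<close>; being positive, it forces the height to be exactly
  \<open>Suc h\<close>.\<close>

lemma ex_tree_a1_leaf_pairs:
  assumes "2 ^ h \<le> m" "m < 2 ^ Suc h"
  shows "\<exists>t :: unit tree. size t = m \<and> height t = Suc h \<and> leaf_pairs (Suc h) t = a1 m"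
proof -
  have le: "a1 m \<le> 2 ^ h" using assms(2) by (rule a1_le_power)
  have "Suc h \<le> m" using less_exp[of h] assms(1) by linarith
  then have pos: "1 \<le> a1 m"
    using le_a1_iff[OF assms, of 1] min_inner_one[of "Suc h"] by simp
  \<comment> \<open>Below \<open>2 ^ h\<close>, one more pair would need more than \<open>m\<close>
    nodes, while \<open>min_inner_le\<close> caps that need.\<close>
  have "m \<le> 2 ^ h - 1 + a1 m"
  proof (cases "a1 m = 2 ^ h")
    case False
    then have "Suc (a1 m) \<le> 2 ^ h" using le by simp
    then have "m < min_inner (Suc h) (Suc (a1 m))" "min_inner (Suc h) (Suc (a1 m)) \<le> 2 ^ h + a1 m"
      using le_a1_iff[OF assms, of "Suc (a1 m)"] min_inner_le[of "Suc (a1 m)" h] by auto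
    then show ?thesis by simp
  qed (use assms(2) in simp)
  then obtain t :: "unit tree"
    where "size t = m" "height t \<le> Suc h" "leaf_pairs (Suc h) t = a1 m"
    using ex_tree_leaf_pairs[OF le] le_a1_iff[OF assms le] by auto
  moreover from this have "Suc h \<le> height t"
    using pos by (intro leaf_pairs_pos_imp_le_height) simp
  ultimately show ?thesis by (intro exI[of _ t]) simp
qed

theorem corollary3p4:
  fixes n :: nat
  assumes "n \<ge> 2"
  shows "a_max n = max_leaf_pairs n (nat \<lceil>log 2 (real n)\<rceil>)
       \<and> max_leaf_pairs n (nat \<lceil>log 2 (real n)\<rceil>) = a1 (n - 1)"
proof -
  obtain h where h: "2 ^ h < n" "n \<le> 2 ^ (h + 1)"
    using ex_power_ivl2[of 2 n] assms by auto
  have lg: "nat \<lceil>log 2 (real n)\<rceil> = Suc h"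
    using ceiling_log_nat_eq_if[OF h] by simp
  have m: "2 ^ h \<le> n - 1" "n - 1 < 2 ^ Suc h" using h by auto
  have upper: "leaf_pairs g t \<le> a1 (n - 1)" if "t \<in> trees_with n g" for g t
  proof -
    have "size t = n - 1" "height t = g"
      using that by (auto simp: trees_with_def size1_size)
    then show ?thesis using leaf_pairs_le_a1[of h t] m by simp
  qed
  then have max_le: "max_leaf_pairs n g \<le> a1 (n - 1)" for g
    by (auto simp: max_leaf_pairs_def finite_leaf_pairs)
  obtain t where t: "t \<in> trees_with n (Suc h)" "leaf_pairs (Suc h) t = a1 (n - 1)"
    using ex_tree_a1_leaf_pairs[OF m] assms unfolding trees_with_def size1_size by force
  have "leaf_pairs (Suc h) t \<le> max_leaf_pairs n (Suc h)"
    using t(1) by (auto simp: max_leaf_pairs_def finite_leaf_pairs intro!: Max_ge)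
  then have eq: "max_leaf_pairs n (Suc h) = a1 (n - 1)"
    using max_le t(2) by (intro antisym) simp_all
  \<comment> \<open>This puts the optimal height within the range of heights in
    \<open>a_max\<close>.\<close>
  have "Suc h \<le> n - 1" using less_exp[of h] m(1) by linarith
  then have "a_max n = a1 (n - 1)"
    unfolding a_max_def using max_le eq by (intro Max_eqI) (auto intro: exI[of _ "Suc h"])
  then show ?thesis using eq lg by simp
qed

end
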